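(* Suppose $n\ge 3$. There exist a sub-Gaussian noise $\xi_i$, a function $f^*\in\mathcal{H}^1([0,1]^d)$, a probability measure $P_X$ on $[0,1]^d$, and $h\in(0,1)$ such that the ordinary adversarial training estimator $$\check f=\operatorname*{argmin}_{f\in\mathcal{F}(L,W)}\ \frac1n\sum_{i=1}^n\ \sup_{x'\in\Delta_h^p(X_i)}(Y_i-f(x'))^2$$ satisfies the following inequality, with an existing constant $c^*>0$, with probability at least $0.5$: $$\|\check f-f^*\|_{L^2(P_X)}^2\ \ge\ c^*.$$
   Context: Regression model: $(X_1,Y_1),\dots,(X_n,Y_n)\in[0,1]^d\times\mathbb{R}$, $d\in\mathbb{N}$, are i.i.d. copies of $(X,Y)$ with $Y=f^*(X)+\xi$, where $X\sim P_X$ and the noise $\xi$ (with copies $\xi_i$) has zero mean and finite variance and is independent of $X$. Neighbourhood: $\Delta_h^p(x)=\{x'\in[0,1]^d:\|x-x'\|_p\le h\}$, with an order $p\ge1$ ($p=\infty$ allowed). $\|g\|_{L^2(P_X)}^2=\mathbb{E}_{X\sim P_X}[g(X)^2]$ and $\|g\|_{L^\infty}=\sup_{x\in[0,1]^d}|g(x)|$. Hölder ball (radius $B\ge1$): for $\beta>0$, with multi-indices $b$ having non-negative integer entries and $\lfloor\beta\rfloor$ the largest integer no more than $\beta$, $\mathcal{H}^\beta([0,1]^d)$ is the set of $f:[0,1]^d\to\mathbb{R}$ with $$\sum_{b:\|b\|_1<\lfloor\beta\rfloor}\|\partial^b f\|_{L^\infty}+\sum_{b:\|b\|_1=\lfloor\beta\rfloor}\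 \sup_{x\ne x'\in[0,1]^d}\frac{|\partial^bf(x)-\partial^bf(x')|}{\|x-x'\|_\infty^{\beta-\lfloor\beta\rfloor}}\le B.$$ Neural networks: $(L,W)\in\mathbb{N}^2$ is the given architecture. For widths $\mathcal{W}=(W_1,\dots,W_{L+1})$ with $W_1=d$, $W_{L+1}=1$, a network is $f_\theta=g_L\circ\cdots\circ g_1$ with $g_\ell(z)=\sigma(A_\ell z+b_\ell)$ for $\ell\le L-1$, $g_L(z)=A_Lz+b_L$, where $\sigma$ is the componentwise ReLU $\sigma(z)_i=\max\{z_i,0\}$, $A_\ell\in\mathbb{R}^{W_{\ell+1}\times W_\ell}$, $b_\ell\in\mathbb{R}^{W_{\ell+1}}$. $\mathcal{F}(L,W)$ is the set of all such functions on $[0,1]^d$ (with arbitrary real parameters) with $\max_\ell W_\ell\le W$ and $\|f_\theta\|_{L^\infty}\le B$, where $B\ge1$. *)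

theory Defs
  imports "HOL-Probability.Probability"
begin

text \<open>Here \<open>1\<close> is the all-ones vector, so this is $[0,1]^d$ with $d =$ \<open>CARD('d)\<close>.\<close>

definition unit_cube :: "(real ^ 'd) set" where
  "unit_cube = cbox 0 1"

definition lp_norm :: "ereal \<Rightarrow> real ^ 'd \<Rightarrow> real" where
  "lp_norm p x =
     (if p = \<infinity> then infnorm x
      else (\<Sum>i\<in>UNIV. \<bar>x $ i\<bar> powr real_of_ereal p) powr (1 / real_of_ereal p))"

definition nbhd :: "ereal \<Rightarrow> real \<Rightarrow> real ^ 'd \<Rightarrow> (real ^ 'd) set" where
  "nbhd p h x = {x' \<in> unit_cube. lp_norm p (x - x') \<le> h}"

text \<open>Suprema are taken in \<open>ennreal\<close>, so that unbounded functions have norm \<open>\<infinity>\<close>.\<close>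

definition linf_norm :: "(real ^ 'd \<Rightarrow> real) \<Rightarrow> ennreal" where
  "linf_norm g = (SUP x\<in>unit_cube. ennreal \<bar>g x\<bar>)"

definition l2_norm_sq :: "(real ^ 'd) measure \<Rightarrow> (real ^ 'd \<Rightarrow> real) \<Rightarrow> real" where
  "l2_norm_sq P g = (\<integral>x. (g x)\<^sup>2 \<partial>P)"


text \<open>
  \<open>partials m f D\<close>: the function \<open>D b\<close> is the partial derivative of \<open>f\<close> with respect to the
  multi-index \<open>b\<close>, for all \<open>b\<close> of order at most \<open>m\<close>. Derivatives are taken within the cube,
  hence one-sided on its boundary; the values of \<open>D b\<close> on the cube are uniquely determined by
  \<open>f\<close>. All mixed derivatives are required to exist and not to depend on the order of
  differentiation.
\<close>

definition partials ::
  "nat \<Rightarrow> (real ^ 'd \<Rightarrow> real) \<Rightarrow> (('d \<Rightarrow> nat) \<Rightarrow> real ^ 'd \<Rightarrow> real) \<Rightarrow> bool" where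
  "partials m f D \<longleftrightarrow>
     (\<forall>x\<in>unit_cube. D (\<lambda>_. 0) x = f x) \<and>
     (\<forall>b i. \<forall>x\<in>unit_cube. sum b UNIV < m \<longrightarrow>
        ((\<lambda>t. D b (\<chi> j. if j = i then t else x $ j))
           has_real_derivative D (b(i := Suc (b i))) x) (at (x $ i) within {0..1}))"

definition holder_seminorm :: "real \<Rightarrow> (real ^ 'd \<Rightarrow> real) \<Rightarrow> ennreal" where
  "holder_seminorm \<alpha> g =
     (SUP (x, x') \<in> {(x, x'). x \<in> unit_cube \<and> x' \<in> unit_cube \<and> x \<noteq> x'}.
        ennreal (\<bar>g x - g x'\<bar> / infnorm (x - x') powr \<alpha>))"

definition holder_ball :: "real \<Rightarrow> real \<Rightarrow> (real ^ 'd \<Rightarrow> real) set" where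
  "holder_ball B \<beta> = {f. \<exists>D. partials (nat \<lfloor>\<beta>\<rfloor>) f D \<and>
     (\<Sum>b | sum b UNIV < nat \<lfloor>\<beta>\<rfloor>. linf_norm (D b)) +
     (\<Sum>b | sum b UNIV = nat \<lfloor>\<beta>\<rfloor>. holder_seminorm (\<beta> - of_int \<lfloor>\<beta>\<rfloor>) (D b)) \<le> ennreal B}"

text \<open>The index sets of the two sums above are finite.\<close>

lemma finite_multi_indices: "finite {b :: 'd::finite \<Rightarrow> nat. sum b UNIV \<le> m}"
proof (rule finite_subset)
  show "{b :: 'd \<Rightarrow> nat. sum b UNIV \<le> m} \<subseteq> PiE UNIV (\<lambda>_. {..m})"
  proof
    fix b :: "'d \<Rightarrow> nat"
    assume "b \<in> {b. sum b UNIV \<le> m}"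
    then have "b i \<le> m" for i
      using member_le_sum[of i UNIV b] by (metis UNIV_I finite le_trans mem_Collect_eq zero_le)
    then show "b \<in> PiE UNIV (\<lambda>_. {..m})" by auto
  qed
qed (simp add: finite_PiE)


text \<open>
  The widths of the hidden layers vary, so a layer vector is a function \<open>nat \<Rightarrow> real\<close> of which only
  the first \<open>w l\<close> entries are ever read. Layers are numbered from 1: layer \<open>l\<close> maps
  $\mathbb{R}^{w_l}$ to $\mathbb{R}^{w_{l+1}}$. Inputs are read through a fixed enumeration
  of the coordinates; the resulting class of networks is independent of it.
\<close>

definition input_vec :: "real ^ 'd \<Rightarrow> nat \<Rightarrow> real" where
  "input_vec x i = x $ from_nat_into UNIV i"

definition affine_layer ::
  "nat \<Rightarrow> (nat \<Rightarrow> nat \<Rightarrow> real) \<Rightarrow> (nat \<Rightarrow> real) \<Rightarrow> (nat \<Rightarrow> real) \<Rightarrow> nat \<Rightarrow> real" where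
  "affine_layer k A b z i = (\<Sum>j<k. A i j * z j) + b i"

definition relu :: "(nat \<Rightarrow> real) \<Rightarrow> nat \<Rightarrow> real" where
  "relu z i = max (z i) 0"

primrec hidden_layers ::
  "(nat \<Rightarrow> nat) \<Rightarrow> (nat \<Rightarrow> nat \<Rightarrow> nat \<Rightarrow> real) \<Rightarrow> (nat \<Rightarrow> nat \<Rightarrow> real) \<Rightarrow> nat \<Rightarrow>
   (nat \<Rightarrow> real) \<Rightarrow> nat \<Rightarrow> real" where
  "hidden_layers w A b 0 z = z"
| "hidden_layers w A b (Suc l) z =
     relu (affine_layer (w (Suc l)) (A (Suc l)) (b (Suc l)) (hidden_layers w A b l z))"

text \<open>The output layer has width 1; its only entry has index 0.\<close>

definition network ::
  "nat \<Rightarrow> (nat \<Rightarrow> nat) \<Rightarrow> (nat \<Rightarrow> nat \<Rightarrow> nat \<Rightarrow> real) \<Rightarrow> (nat \<Rightarrow> nat \<Rightarrow> real) \<Rightarrow>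
   real ^ 'd \<Rightarrow> real" where
  "network L w A b x =
     affine_layer (w L) (A L) (b L) (hidden_layers w A b (L - 1) (input_vec x)) 0"

definition network_class :: "real \<Rightarrow> nat \<Rightarrow> nat \<Rightarrow> (real ^ 'd \<Rightarrow> real) set" where
  "network_class B L W =
     {f. \<exists>w A b. w 1 = CARD('d) \<and> w (L + 1) = 1 \<and> (\<forall>l\<in>{1..L + 1}. 1 \<le> w l \<and> w l \<le> W) \<and>
         f = network L w A b \<and> linf_norm f \<le> ennreal B}"


text \<open>A law \<open>N\<close> on \<open>\<real>\<close> is sub-Gaussian if its moment generating function is dominated by that of
  a centred Gaussian; point masses at 0 are included.\<close>

definition sub_gaussian :: "real measure \<Rightarrow> bool" where
  "sub_gaussian N \<longleftrightarrow>
     (\<exists>s. \<forall>t. integrable N (\<lambda>x. exp (t * x)) \<and> (\<integral>x. exp (t * x) \<partial>N) \<le> exp (s\<^sup>2 * t\<^sup>2 / 2))"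

definition noise_law :: "real measure \<Rightarrow> bool" where
  "noise_law N \<longleftrightarrow> prob_space N \<and> sets N = sets borel \<and>
     integrable N (\<lambda>x. x\<^sup>2) \<and> (\<integral>x. x \<partial>N) = 0"

definition design_law :: "(real ^ 'd) measure \<Rightarrow> bool" where
  "design_law P \<longleftrightarrow> prob_space P \<and> sets P = sets (restrict_space borel unit_cube)"

text \<open>The joint law of \<open>n\<close> independent copies of \<open>(X, \<xi>)\<close> with \<open>X\<close> and \<open>\<xi>\<close> independent.\<close>

definition sample_law ::
  "nat \<Rightarrow> (real ^ 'd) measure \<Rightarrow> real measure \<Rightarrow> (nat \<Rightarrow> (real ^ 'd) \<times> real) measure" where
  "sample_law n P N = PiM {..<n} (\<lambda>_. P \<Otimes>\<^sub>M N)"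

definition observations ::
  "(real ^ 'd \<Rightarrow> real) \<Rightarrow> (nat \<Rightarrow> (real ^ 'd) \<times> real) \<Rightarrow> nat \<Rightarrow> (real ^ 'd) \<times> real" where
  "observations f \<omega> i = (fst (\<omega> i), f (fst (\<omega> i)) + snd (\<omega> i))"

definition adv_risk ::
  "ereal \<Rightarrow> real \<Rightarrow> nat \<Rightarrow> (nat \<Rightarrow> (real ^ 'd) \<times> real) \<Rightarrow> (real ^ 'd \<Rightarrow> real) \<Rightarrow> real" where
  "adv_risk p h n z f =
     1 / real n * (\<Sum>i<n. SUP x'\<in>nbhd p h (fst (z i)). (snd (z i) - f x')\<^sup>2)"

definition adv_estimators ::
  "ereal \<Rightarrow> real \<Rightarrow> real \<Rightarrow> nat \<Rightarrow> nat \<Rightarrow> nat \<Rightarrow> (nat \<Rightarrow> (real ^ 'd) \<times> real) \<Rightarrow>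
   (real ^ 'd \<Rightarrow> real) set" where
  "adv_estimators p h B L W n z =
     {f. is_arg_min (adv_risk p h n z) (\<lambda>f. f \<in> network_class B L W) f}"

end

theory Submission
  imports Defs
begin

text \<open>
  Take no noise, and let the design be uniform on two points lying in each other's neighbourhoods,
  at which \<open>fstar\<close> takes different values. The adversarial risk of any \<open>f\<close> is at least the
  empirical squared loss of the constant \<open>f u\<close>, for either design point \<open>u\<close>; by strict convexity
  this is minimal only when \<open>f u\<close> is the mean of the responses. Constants are networks, so the
  constant mean is a minimiser, and every minimiser takes the same value at both design points,
  hence cannot be close to \<open>fstar\<close>.
\<close>

section \<open>Sup-norm bounds and the variance decomposition\<close>

lemma linf_norm_le_iff:
  assumes "0 \<le> B"
  shows "linf_norm f \<le> ennreal B \<longleftrightarrow> (\<forall>x\<in>unit_cube. \<bar>f x\<bar> \<le> B)"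
  using assms by (simp add: linf_norm_def SUP_le_iff)

text \<open>The cross term vanishes because deviations from the mean sum to zero. The quadratic
  excess is what later makes the value of a minimiser unique.\<close>

lemma sum_square_diff_mean:
  fixes y :: "nat \<Rightarrow> real"
  assumes "0 < n" and m: "m = (\<Sum>i<n. y i) / real n"
  shows "(\<Sum>i<n. (y i - c)\<^sup>2) = (\<Sum>i<n. (y i - m)\<^sup>2) + real n * (m - c)\<^sup>2"
proof -
  have s: "(\<Sum>i<n. y i) = real n * m"
    using assms by simp
  have "(\<Sum>i<n. (y i - c)\<^sup>2) = (\<Sum>i<n. (y i - m)\<^sup>2 + (2 * (m - c) * y i + (c\<^sup>2 - m\<^sup>2)))"
    by (intro sum.cong) (auto simp: power2_eq_square algebra_simps)
  also have "\<dots> = (\<Sum>i<n. (y i - m)\<^sup>2) + (2 * (m - c) * (\<Sum>i<n. y i) + real n * (c\<^sup>2 - m\<^sup>2))"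
    by (simp add: sum.distrib sum_distrib_left)
  also have "\<dots> = (\<Sum>i<n. (y i - m)\<^sup>2) + real n * (m - c)\<^sup>2"
    unfolding s by (simp add: power2_eq_square algebra_simps)
  finally show ?thesis .
qed

subsection \<open>Networks\<close>

lemma borel_measurable_hidden_layers [measurable]:
  "(\<lambda>x :: real ^ 'd. hidden_layers w A b l (input_vec x) i) \<in> borel_measurable borel"
proof (induction l arbitrary: i)
  case 0
  have "continuous_on UNIV (\<lambda>x :: real ^ 'd. x $ from_nat_into UNIV i)"
    by (intro continuous_intros)
  then show ?case
    by (simp add: input_vec_def borel_measurable_continuous_onI)
next
  case (Suc l)
  note Suc[measurable]
  show ?case
    by (simp add: relu_def affine_layer_def)
qed

lemma borel_measurable_network: "network L w A b \<in> borel_measurable borel"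
  unfolding network_def[abs_def] affine_layer_def by measurable

lemma borel_measurable_network_class:
  "f \<in> network_class B L W \<Longrightarrow> f \<in> borel_measurable borel"
  by (auto simp: network_class_def borel_measurable_network)

lemma const_in_network_class:
  assumes "1 \<le> L" and "CARD('d::finite) \<le> W" and "\<bar>m\<bar> \<le> B"
  shows "(\<lambda>x :: real ^ 'd. m) \<in> network_class B L W"
proof -
  \<comment> \<open>Only the input layer is wide. As \<open>1 \<le> L\<close>, the output index
    \<open>L + 1\<close> differs from 1 and so gets width 1.\<close>
  define w where "w l = (if l = 1 then CARD('d) else 1)" for l :: nat
  have "1 \<le> CARD('d)"
    by (simp add: Suc_le_eq)
  then have "1 \<le> W"
    using assms(2) by (rule order_trans)
  then have "1 \<le> w l \<and> w l \<le> W" for l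
    using assms(2) by (auto simp: w_def Suc_le_eq)
  moreover have "w 1 = CARD('d)" "w (L + 1) = 1"
    using assms(1) by (auto simp: w_def)
  \<comment> \<open>With all weights zero only the bias of the output layer survives.\<close>
  moreover have "(\<lambda>x :: real ^ 'd. m) = network L w (\<lambda>_ _ _. 0) (\<lambda>_ _. m)"
    by (auto simp: network_def affine_layer_def)
  moreover have "linf_norm (\<lambda>x :: real ^ 'd. m) \<le> ennreal B"
    using assms(3) by (subst linf_norm_le_iff) auto
  ultimately show ?thesis
    unfolding network_class_def by blast
qed

subsection \<open>Adversarial training with overlapping neighbourhoods\<close>

text \<open>The point \<open>u\<close> is an admissible perturbation of every sample point at once,
  so it competes in each inner supremum.\<close>

lemma adv_risk_ge:
  assumes bdd: "\<And>x. x \<in> unit_cube \<Longrightarrow> \<bar>f x\<bar> \<le> B"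
    and u: "\<And>i. i < n \<Longrightarrow> u \<in> nbhd p h (fst (z i))"
  shows "adv_risk p h n z f \<ge> 1 / real n * (\<Sum>i<n. (snd (z i) - f u)\<^sup>2)"
  unfolding adv_risk_def
proof (intro mult_left_mono sum_mono)
  fix i assume "i \<in> {..<n}"
  then have "u \<in> nbhd p h (fst (z i))"
    using u by simp
  \<comment> \<open>A real-valued supremum is an upper bound only for sets bounded above; the
    sup-norm bound on \<open>f\<close> provides this.\<close>
  moreover have "bdd_above ((\<lambda>x'. (snd (z i) - f x')\<^sup>2) ` nbhd p h (fst (z i)))"
  proof (rule bdd_aboveI2)
    fix x' assume "x' \<in> nbhd p h (fst (z i))"
    then have "\<bar>snd (z i) - f x'\<bar> \<le> \<bar>\<bar>snd (z i)\<bar> + B\<bar>"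
      using bdd[of x'] by (auto simp: nbhd_def)
    then show "(snd (z i) - f x')\<^sup>2 \<le> (\<bar>snd (z i)\<bar> + B)\<^sup>2"
      by (simp add: abs_le_square_iff)
  qed
  ultimately show "(snd (z i) - f u)\<^sup>2 \<le> (SUP x'\<in>nbhd p h (fst (z i)). (snd (z i) - f x')\<^sup>2)"
    by (rule cSUP_upper)
qed simp

lemma adv_risk_const:
  assumes "\<And>i. i < n \<Longrightarrow> nbhd p h (fst (z i)) \<noteq> {}"
  shows "adv_risk p h n z (\<lambda>_. m) = 1 / real n * (\<Sum>i<n. (snd (z i) - m)\<^sup>2)"
  using assms by (simp add: adv_risk_def)

text \<open>Here \<open>U\<close> collects points lying in all the neighbourhoods simultaneously.
  Both claims follow from one inequality, in which moving \<open>f u\<close> away from the mean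
  costs at least the squared deviation.\<close>

lemma
  fixes z :: "nat \<Rightarrow> (real ^ 'd) \<times> real"
  assumes "0 < n" and LW: "1 \<le> L" "CARD('d) \<le> W"
    and resp: "\<And>i. i < n \<Longrightarrow> \<bar>snd (z i)\<bar> \<le> B"
    and U: "U \<noteq> {}" "\<And>i. i < n \<Longrightarrow> U \<subseteq> nbhd p h (fst (z i))"
  shows mean_in_adv_estimators:
      "(\<lambda>_. (\<Sum>i<n. snd (z i)) / real n) \<in> adv_estimators p h B L W n z"
    and adv_estimators_eq_mean:
      "f \<in> adv_estimators p h B L W n z \<Longrightarrow> u \<in> U \<Longrightarrow> f u = (\<Sum>i<n. snd (z i)) / real n"
proof -
  define m where "m = (\<Sum>i<n. snd (z i)) / real n"
  have "\<bar>\<Sum>i<n. snd (z i)\<bar> \<le> (\<Sum>i<n. \<bar>snd (z i)\<bar>)"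
    by (rule sum_abs)
  also have "\<dots> \<le> real n * B"
    using sum_bounded_above[of "{..<n}" "\<lambda>i. \<bar>snd (z i)\<bar>" B] resp by simp
  finally have "\<bar>m\<bar> \<le> B"
    using \<open>0 < n\<close> by (simp add: m_def field_simps)
  then have const: "(\<lambda>x :: real ^ 'd. m) \<in> network_class B L W"
    using LW by (rule const_in_network_class[rotated 2])
  have "0 \<le> B"
    using resp[of 0] \<open>0 < n\<close> by linarith
  \<comment> \<open>The pointwise lower bound at \<open>u\<close>, combined with the variance
    decomposition divided by \<open>n\<close>.\<close>
  have ge: "adv_risk p h n z (\<lambda>_. m) + (m - f u)\<^sup>2 \<le> adv_risk p h n z f"
    if "f \<in> network_class B L W" "u \<in> U" for f u
  proof -
    have "\<And>x. x \<in> unit_cube \<Longrightarrow> \<bar>f x\<bar> \<le> B"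
      using that(1) \<open>0 \<le> B\<close> by (auto simp: network_class_def linf_norm_le_iff)
    then have "1 / real n * (\<Sum>i<n. (snd (z i) - f u)\<^sup>2) \<le> adv_risk p h n z f"
      using U(2) that(2) by (intro adv_risk_ge) auto
    moreover have "adv_risk p h n z (\<lambda>_. m) = 1 / real n * (\<Sum>i<n. (snd (z i) - m)\<^sup>2)"
      using U by (intro adv_risk_const) blast
    ultimately show ?thesis
      using sum_square_diff_mean[OF \<open>0 < n\<close> m_def, of "f u"] \<open>0 < n\<close>
      by (simp add: add_divide_distrib)
  qed
  obtain u0 where "u0 \<in> U"
    using U(1) by blast
  have "adv_risk p h n z (\<lambda>_. m) \<le> adv_risk p h n z f" if "f \<in> network_class B L W" for f
    using ge[OF that \<open>u0 \<in> U\<close>] zero_le_power2[of "m - f u0"] by linarith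
  then show "(\<lambda>_. (\<Sum>i<n. snd (z i)) / real n) \<in> adv_estimators p h B L W n z"
    using const unfolding m_def[symmetric] adv_estimators_def is_arg_min_def
    by (auto simp: not_less)
  show "f u = (\<Sum>i<n. snd (z i)) / real n"
    if "f \<in> adv_estimators p h B L W n z" "u \<in> U"
  proof -
    have "f \<in> network_class B L W" "\<not> adv_risk p h n z (\<lambda>_. m) < adv_risk p h n z f"
      using that(1) const by (auto simp: adv_estimators_def is_arg_min_def)
    then have "(m - f u)\<^sup>2 \<le> 0"
      using ge[of f u] that(2) by linarith
    then show ?thesis
      by (simp add: m_def)
  qed
qed

subsection \<open>The regression function, the noise and the design\<close>

text \<open>For \<beta> = 1 the Hoelder exponent is 0, so the top-order term measures only the
  oscillation of the first partials. These are constant, which leaves the sup norm of the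
  coordinate, at most 1 on the cube.\<close>

lemma coordinate_in_holder_ball:
  fixes i :: "'d::finite"
  assumes "1 \<le> B"
  shows "(\<lambda>x :: real ^ 'd. x $ i) \<in> holder_ball B 1"
proof -
  \<comment> \<open>The final 0 covers the partials in the other directions as well as all higher
    orders.\<close>
  define D :: "('d \<Rightarrow> nat) \<Rightarrow> real ^ 'd \<Rightarrow> real"
    where "D b x = (if b = (\<lambda>_. 0) then x $ i else if b = (\<lambda>_. 0)(i := 1) then 1 else 0)" for b x
  have sum_less: "sum b UNIV < Suc 0 \<longleftrightarrow> b = (\<lambda>_. 0)" for b :: "'d \<Rightarrow> nat"
    by auto
  have "partials (Suc 0) (\<lambda>x :: real ^ 'd. x $ i) D"
    unfolding partials_def sum_less
  proof (intro conjI ballI allI impI)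
    fix b :: "'d \<Rightarrow> nat" and k :: 'd and x :: "real ^ 'd"
    assume b: "b = (\<lambda>_. 0)"
    have "((\<lambda>t. if i = k then t else x $ i) has_real_derivative (if i = k then 1 else 0))
        (at (x $ k) within {0..1})"
      by auto
    moreover have "D (b(k := Suc (b k))) x = (if i = k then 1 else 0)"
      by (auto simp: b D_def fun_eq_iff)
    ultimately show "((\<lambda>t. D b (\<chi> j. if j = k then t else x $ j)) has_real_derivative
        D (b(k := Suc (b k))) x) (at (x $ k) within {0..1})"
      by (simp add: b D_def)
  qed (simp add: D_def)
  moreover have "linf_norm (D (\<lambda>_. 0)) \<le> ennreal B"
  proof -
    have "0 \<le> x $ i \<and> x $ i \<le> 1" if "x \<in> unit_cube" for x :: "real ^ 'd"
      using that by (auto simp: unit_cube_def mem_box_cart)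
    then have "\<bar>D (\<lambda>_. 0) x\<bar> \<le> B" if "x \<in> unit_cube" for x
      using that assms by (fastforce simp: D_def)
    then show ?thesis
      using assms by (subst linf_norm_le_iff) auto
  qed
  moreover have "holder_seminorm 0 (D b) = 0" if "sum b UNIV = Suc 0" for b
  proof -
    have "b \<noteq> (\<lambda>_. 0)"
      using that by auto
    then have "D b x = D b x'" for x x'
      by (simp add: D_def)
    then have "\<bar>D b x - D b x'\<bar> = 0" for x x'
      by (metis abs_zero diff_self)
    then have "holder_seminorm 0 (D b) \<le> 0"
      unfolding holder_seminorm_def by (intro SUP_least) auto
    then show ?thesis
      by simp
  qed
  ultimately have "partials (nat \<lfloor>1 :: real\<rfloor>) (\<lambda>x :: real ^ 'd. x $ i) D \<and>
      (\<Sum>b | sum b UNIV < nat \<lfloor>1 :: real\<rfloor>. linf_norm (D b)) +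
      (\<Sum>b | sum b UNIV = nat \<lfloor>1 :: real\<rfloor>. holder_seminorm (1 - of_int \<lfloor>1 :: real\<rfloor>) (D b))
      \<le> ennreal B"
    by (simp add: sum_less del: less_one less_Suc0 sum_eq_0_iff)
  then show ?thesis
    unfolding holder_ball_def by blast
qed

lemma integrable_return:
  fixes g :: "'a \<Rightarrow> real"
  assumes "x \<in> space M" and "g \<in> borel_measurable M"
  shows "integrable (return M x) g"
  using assms by (simp add: integrable_iff_bounded nn_integral_return)

lemma noise_law_return: "noise_law (return borel 0)"
  by (auto simp: noise_law_def prob_space_return integral_return integrable_return)

text \<open>The moment generating function is constantly 1, so any \<open>s\<close> will do.\<close>

lemma sub_gaussian_return: "sub_gaussian (return borel 0)"
  by (auto simp: sub_gaussian_def integral_return integrable_return)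

text \<open>Pushing a fair coin forward into the restricted space gives the sigma-algebra demanded
  by \<open>design_law\<close> and turns integrals into two-term averages.\<close>

definition two_point_law :: "real ^ 'd \<Rightarrow> real ^ 'd \<Rightarrow> (real ^ 'd) measure" where
  "two_point_law u v = distr (measure_pmf (bernoulli_pmf (1 / 2)))
     (restrict_space borel unit_cube) (\<lambda>b. if b then u else v)"

context
  fixes u v :: "real ^ 'd"
  assumes uv: "u \<in> unit_cube" "v \<in> unit_cube"
begin

lemma measurable_two_points:
  "(\<lambda>b. if b then u else v) \<in> measure_pmf (bernoulli_pmf (1 / 2)) \<rightarrow>\<^sub>M restrict_space borel unit_cube"
  using uv by (auto simp: space_restrict_space)

lemma design_law_two_point_law: "design_law (two_point_law u v)"
  unfolding design_law_def two_point_law_def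
  by (auto intro!: measure_pmf.prob_space_distr measurable_two_points)

lemma l2_norm_sq_two_point_law:
  assumes "g \<in> borel_measurable borel"
  shows "l2_norm_sq (two_point_law u v) g = ((g u)\<^sup>2 + (g v)\<^sup>2) / 2"
proof -
  have "(\<lambda>x. (g x)\<^sup>2) \<in> borel_measurable (restrict_space borel unit_cube)"
    using assms by (intro measurable_restrict_space1) measurable
  then show ?thesis
    by (simp add: l2_norm_sq_def two_point_law_def integral_distr[OF measurable_two_points]
        integral_bernoulli_pmf)
qed

lemma sets_two_points: "{u, v} \<in> sets (two_point_law u v)"
  using uv unfolding two_point_law_def sets_distr
  by (subst sets_restrict_space_iff) (auto simp: unit_cube_def)

lemma emeasure_two_points: "emeasure (two_point_law u v) {u, v} = 1"
proof -
  have "(\<lambda>b. if b then u else v) -` {u, v} = UNIV"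
    by auto
  then show ?thesis
    using sets_two_points measure_pmf.emeasure_space_1
    by (simp add: two_point_law_def emeasure_distr[OF measurable_two_points])
qed

text \<open>This box is the event on which the theorem is proved. Each of its sides has probability
  1, hence so does the product.\<close>

lemma
  shows sets_noiseless_samples:
      "PiE {..<n} (\<lambda>_. {u, v} \<times> {0}) \<in> sets (sample_law n (two_point_law u v) (return borel 0))"
    and measure_noiseless_samples:
      "measure (sample_law n (two_point_law u v) (return borel 0)) (PiE {..<n} (\<lambda>_. {u, v} \<times> {0})) = 1"
proof -
  interpret P: prob_space "two_point_law u v"
    using design_law_two_point_law by (simp add: design_law_def)
  interpret N: prob_space "return borel (0 :: real)"
    by (simp add: prob_space_return)
  interpret PN: pair_prob_space "two_point_law u v" "return borel (0 :: real)" ..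
  interpret S: finite_product_prob_space
    "\<lambda>_. two_point_law u v \<Otimes>\<^sub>M return borel (0 :: real)" "{..<n}"
    by unfold_locales auto
  have sets: "{u, v} \<times> {0} \<in> sets (two_point_law u v \<Otimes>\<^sub>M return borel (0 :: real))"
    using sets_two_points by (intro pair_measureI) auto
  then show "PiE {..<n} (\<lambda>_. {u, v} \<times> {0}) \<in>
      sets (sample_law n (two_point_law u v) (return borel 0))"
    unfolding sample_law_def by (intro sets_PiM_I_finite) auto
  have "emeasure (two_point_law u v \<Otimes>\<^sub>M return borel (0 :: real)) ({u, v} \<times> {0}) = 1"
    using sets_two_points
    by (simp add: N.emeasure_pair_measure_Times emeasure_two_points
        del: insert_Times_insert)
  then show "measure (sample_law n (two_point_law u v) (return borel 0))
      (PiE {..<n} (\<lambda>_. {u, v} \<times> {0})) = 1"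
    unfolding sample_law_def using sets
    by (subst S.finite_measure_PiM_emb) (auto simp: measure_def)
qed

end

section \<open>Distances along an axis and the lower bound\<close>

lemma lp_norm_0: "lp_norm p 0 = 0"
  by (simp add: lp_norm_def infnorm_0)

text \<open>Along a coordinate axis all these norms agree, so one pair of design points serves every
  \<open>p\<close>.\<close>

lemma lp_norm_axis:
  assumes "1 \<le> p"
  shows "lp_norm p (axis i c :: real ^ 'd) = \<bar>c\<bar>"
proof (cases "p = \<infinity>")
  case True
  have "infnorm (axis i c :: real ^ 'd) = \<bar>c\<bar>"
    unfolding infnorm_cart
    by (rule cSup_eq_maximum) (auto simp: axis_def intro: exI[of _ i])
  then show ?thesis
    using True by (simp add: lp_norm_def)
next
  case False
  then obtain r where r: "p = ereal r" "1 \<le> r"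
    using assms by (cases p) (auto simp: one_ereal_def)
  have "(\<Sum>j\<in>UNIV. \<bar>axis i c $ j\<bar> powr r) = (\<Sum>j\<in>UNIV. if j = i then \<bar>c\<bar> powr r else 0)"
    by (intro sum.cong) (auto simp: axis_def)
  then show ?thesis
    using r by (simp add: lp_norm_def powr_powr)
qed

text \<open>The constant is fixed before \<open>n\<close>, \<open>L\<close> and \<open>W\<close>.
  Asserting that \<open>adv_estimators\<close> is nonempty keeps the bound on all minimisers from
  being vacuous, and the measurable set \<open>A\<close> avoids any claim that the event itself is
  measurable.\<close>

theorem proposition1:
  fixes p :: ereal and B :: real
  assumes "1 \<le> p" and "1 \<le> B"
  shows "\<exists>c>0. \<forall>n\<ge>3. \<forall>L\<ge>1. \<forall>W\<ge>CARD('d::finite).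
    \<exists>N fstar (P :: (real ^ 'd) measure) h.
      noise_law N \<and> sub_gaussian N \<and> fstar \<in> holder_ball B 1 \<and> design_law P \<and> 0 < h \<and> h < 1 \<and>
      (\<exists>A\<in>sets (sample_law n P N). measure (sample_law n P N) A \<ge> 1 / 2 \<and>
        (\<forall>\<omega>\<in>A. adv_estimators p h B L W n (observations fstar \<omega>) \<noteq> {} \<and>
          (\<forall>f\<in>adv_estimators p h B L W n (observations fstar \<omega>).
            l2_norm_sq P (\<lambda>x. f x - fstar x) \<ge> c)))"
\<comment> \<open>The value 1/16 is the least mean squared error of a single value \<open>t\<close>
  against the targets 0 and 1/2, attained at \<open>t = 1 / 4\<close>.\<close>
proof (intro exI[of _ "1 / 16 :: real"] conjI allI impI)
  fix n L W :: nat
  assume n: "3 \<le> n" and L: "1 \<le> L" and W: "CARD('d) \<le> W"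
  define i :: 'd where "i = undefined"
  \<comment> \<open>The two points are at distance exactly \<open>?h\<close>, so the closed
    neighbourhood of each contains both.\<close>
  define u v :: "real ^ 'd" where "u = 0" and "v = axis i (1 / 2)"
  let ?f = "\<lambda>x :: real ^ 'd. x $ i" and ?h = "1 / 2 :: real"
  define A where "A = PiE {..<n} (\<lambda>_. {u, v} \<times> {0 :: real})"
  have cube: "u \<in> unit_cube" "v \<in> unit_cube"
    by (auto simp: u_def v_def unit_cube_def mem_box_cart axis_def)
  have "v - u = axis i (1 / 2)" "u - v = axis i (- 1 / 2)"
    by (auto simp: u_def v_def axis_def vec_eq_iff)
  then have nbhds: "{u, v} \<subseteq> nbhd p ?h x" if "x \<in> {u, v}" for x
    using that cube assms(1) by (auto simp: nbhd_def lp_norm_0 lp_norm_axis)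
  have f: "?f u = 0" "?f v = 1 / 2"
    by (auto simp: u_def v_def)
  have "A \<in> sets (sample_law n (two_point_law u v) (return borel 0))"
    unfolding A_def by (rule sets_noiseless_samples[OF cube])
  moreover have "1 / 2 \<le> measure (sample_law n (two_point_law u v) (return borel 0)) A"
    unfolding A_def measure_noiseless_samples[OF cube] by simp
  moreover have "\<forall>\<omega>\<in>A. adv_estimators p ?h B L W n (observations ?f \<omega>) \<noteq> {} \<and>
      (\<forall>f\<in>adv_estimators p ?h B L W n (observations ?f \<omega>).
        l2_norm_sq (two_point_law u v) (\<lambda>x. f x - ?f x) \<ge> 1 / 16)"
  proof (intro ballI conjI)
    fix \<omega> assume "\<omega> \<in> A"
    let ?z = "observations ?f \<omega>"
    \<comment> \<open>On \<open>A\<close> the noise vanishes, so every response is 0 or 1/2 and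
      hence at most \<open>B\<close> in absolute value.\<close>
    have \<omega>: "fst (\<omega> k) \<in> {u, v}" "snd (\<omega> k) = 0" if "k < n" for k
      using PiE_mem[OF \<open>\<omega> \<in> A\<close>[unfolded A_def], of k] that by auto
    then have resp: "\<bar>snd (?z k)\<bar> \<le> B" if "k < n" for k
      using that f assms(2) by (fastforce simp: observations_def)
    have U: "{u, v} \<subseteq> nbhd p ?h (fst (?z k))" if "k < n" for k
      using nbhds \<omega>(1)[OF that] by (simp add: observations_def)
    have "0 < n"
      using n by simp
    show "adv_estimators p ?h B L W n ?z \<noteq> {}"
      using mean_in_adv_estimators[where z = ?z, OF \<open>0 < n\<close> L W resp insert_not_empty U] by auto
    fix g assume g: "g \<in> adv_estimators p ?h B L W n ?z"
    then have "g \<in> borel_measurable borel"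
      by (auto simp: adv_estimators_def is_arg_min_def intro: borel_measurable_network_class)
    moreover have "?f \<in> borel_measurable borel"
      by (intro borel_measurable_continuous_onI continuous_intros)
    ultimately have "(\<lambda>x. g x - ?f x) \<in> borel_measurable borel"
      by (rule borel_measurable_diff)
    then have "l2_norm_sq (two_point_law u v) (\<lambda>x. g x - ?f x)
        = ((g u)\<^sup>2 + (g v - 1 / 2)\<^sup>2) / 2"
      by (simp add: l2_norm_sq_two_point_law[OF cube] f)
    also have "g u = g v"
      using adv_estimators_eq_mean[where z = ?z, OF \<open>0 < n\<close> L W resp insert_not_empty U g]
      by simp
    \<comment> \<open>Completing the square in the common value \<open>g v\<close> exposes the
      constant.\<close>
    also have "((g v)\<^sup>2 + (g v - 1 / 2)\<^sup>2) / 2 = 1 / 16 + (g v - 1 / 4)\<^sup>2"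
      by (simp add: power2_eq_square field_simps)
    finally show "l2_norm_sq (two_point_law u v) (\<lambda>x. g x - ?f x) \<ge> 1 / 16"
      by simp
  qed
  ultimately show "\<exists>N fstar (P :: (real ^ 'd) measure) h.
      noise_law N \<and> sub_gaussian N \<and> fstar \<in> holder_ball B 1 \<and> design_law P \<and> 0 < h \<and> h < 1 \<and>
      (\<exists>A\<in>sets (sample_law n P N). measure (sample_law n P N) A \<ge> 1 / 2 \<and>
        (\<forall>\<omega>\<in>A. adv_estimators p h B L W n (observations fstar \<omega>) \<noteq> {} \<and>
          (\<forall>f\<in>adv_estimators p h B L W n (observations fstar \<omega>).
            l2_norm_sq P (\<lambda>x. f x - fstar x) \<ge> 1 / 16)))"
    using noise_law_return sub_gaussian_return coordinate_in_holder_ball[OF assms(2)]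
      design_law_two_point_law[OF cube]
    by (intro exI[of _ "return borel 0"] exI[of _ ?f] exI[of _ "two_point_law u v"] exI[of _ ?h]
        conjI bexI[of _ A]) (assumption | simp)+
qed simp

end
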